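(* Let $G_1$ be a broken sun graph of order $n_1$ with no perfect matching and let $G_2$ be a unicyclic graph of order $n_2$ with a perfect matching. If $L(G_1)$ and $L(G_2)$ both have eigenvalue $2$, then, for any one-edge connection $G_1\odot G_2$, the Laplacian matrix $L(G_1\odot G_2)$ has eigenvalue $2$.
   Context: All graphs are finite, undirected, with no loops or multiple edges. The Laplacian matrix of $G$ is $L(G)=D(G)-A(G)$, where $D(G)$ is the diagonal matrix of vertex degrees and $A(G)$ is the adjacency matrix. A unicyclic graph is a connected graph whose number of edges equals its number of vertices. The sun graph of order $2m$ ($m\ge 3$) is the cycle $C_m$ with one pendant vertex attached to each vertex of the cycle. A broken sun graph is a unicyclic subgraph of a sun graph. A one-edge connection $G_1\odot G_2$ of two (vertex-disjoint) graphs $G_1,G_2$ is any graph $G$ with $V(G)=V(G_1)\cup V(G_2)$ and $E(G)=E(G_1)\cup E(G_2)\cup\{uv\}$ for some $u\in V(G_1)$ and $v\in V(G_2)$. *)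

theory Defs
  imports
    "Graph_Theory.Graph_Theory"
    "Jordan_Normal_Form.Char_Poly"
begin

text \<open>
  Finite simple graphs are rendered by \<^locale>\<open>pair_graph\<close>: finite, loop-free, symmetric
  digraphs without parallel arcs. An undirected edge is a pair of opposite arcs, and
  is recovered below as a two-element set of vertices.
\<close>

definition edge_set :: "'a pair_pre_digraph \<Rightarrow> 'a set set" where
  "edge_set G = (\<lambda>(u, v). {u, v}) ` parcs G"

definition perfect_matching :: "'a pair_pre_digraph \<Rightarrow> 'a set set \<Rightarrow> bool" where
  "perfect_matching G M \<longleftrightarrow> M \<subseteq> edge_set G \<and> (\<forall>v \<in> pverts G. \<exists>!e. e \<in> M \<and> v \<in> e)"

definition has_perfect_matching :: "'a pair_pre_digraph \<Rightarrow> bool" where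
  "has_perfect_matching G \<longleftrightarrow> (\<exists>M. perfect_matching G M)"

definition unicyclic :: "'a pair_pre_digraph \<Rightarrow> bool" where
  "unicyclic G \<longleftrightarrow> pair_graph G \<and> Digraph_Component.connected (with_proj G)
     \<and> card (edge_set G) = card (pverts G)"

text \<open>
  The cycle runs through the vertices \<open>Inl 0, \<dots>, Inl (m - 1)\<close>; the pendant vertex at
  \<open>Inl i\<close> is \<open>Inr i\<close>. The operator \<^const>\<open>symcl\<close> adds the reverse of each arc.
\<close>

definition sun_graph :: "nat \<Rightarrow> (nat + nat) pair_pre_digraph" where
  "sun_graph m = \<lparr>
     pverts = Inl ` {..<m} \<union> Inr ` {..<m},
     parcs = symcl ({(Inl i, Inl (Suc i mod m)) | i. i < m} \<union> {(Inl i, Inr i) | i. i < m}) \<rparr>"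

text \<open>
  The concrete sun graph lives on one particular vertex type, so broken sun graphs are
  taken up to isomorphism. Subgraphs need be neither induced nor spanning.
\<close>

definition broken_sun :: "'a pair_pre_digraph \<Rightarrow> bool" where
  "broken_sun G \<longleftrightarrow> pair_graph G \<and>
     (\<exists>m H. m \<ge> 3 \<and> subgraph (with_proj H) (with_proj (sun_graph m)) \<and> unicyclic H
        \<and> digraph_iso (with_proj G) (with_proj H))"

definition one_edge_connection ::
  "'a pair_pre_digraph \<Rightarrow> 'a pair_pre_digraph \<Rightarrow> 'a pair_pre_digraph \<Rightarrow> bool" where
  "one_edge_connection G1 G2 G \<longleftrightarrow>
     pair_graph G1 \<and> pair_graph G2 \<and> pair_graph G
     \<and> pverts G1 \<inter> pverts G2 = {}
     \<and> pverts G = pverts G1 \<union> pverts G2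
     \<and> (\<exists>u \<in> pverts G1. \<exists>v \<in> pverts G2.
          edge_set G = edge_set G1 \<union> edge_set G2 \<union> {{u, v}})"

text \<open>
  Matrices are indexed by natural numbers, so the matrices of a graph are taken with
  respect to an enumeration of its vertices. By symmetry, the degree of a vertex is
  its out-degree.
\<close>

definition vertex_enum :: "'a pair_pre_digraph \<Rightarrow> 'a list \<Rightarrow> bool" where
  "vertex_enum G vs \<longleftrightarrow> distinct vs \<and> set vs = pverts G"

definition degree_mat :: "'a pair_pre_digraph \<Rightarrow> 'a list \<Rightarrow> real mat" where
  "degree_mat G vs = mat_diag (length vs) (\<lambda>i. real (out_degree (with_proj G) (vs ! i)))"

definition adjacency_mat :: "'a pair_pre_digraph \<Rightarrow> 'a list \<Rightarrow> real mat" where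
  "adjacency_mat G vs = mat (length vs) (length vs)
     (\<lambda>(i, j). if (vs ! i, vs ! j) \<in> parcs G then 1 else 0)"

definition laplacian_mat :: "'a pair_pre_digraph \<Rightarrow> 'a list \<Rightarrow> real mat" where
  "laplacian_mat G vs = degree_mat G vs - adjacency_mat G vs"

lemma pair_graph_sun_graph:
  assumes "m \<ge> 3"
  shows "pair_graph (sun_graph m)"
proof -
  have neq: "Suc i mod m \<noteq> i" if "i < m" for i
    using that assms by (cases "Suc i = m") auto
  let ?A = "{(Inl i, Inl (Suc i mod m)) | i. i < m} \<union> {(Inl i, Inr i) | i. i < m}
    :: ((nat + nat) \<times> (nat + nat)) set"
  have A: "?A = (\<lambda>i. (Inl i, Inl (Suc i mod m))) ` {..<m} \<union> (\<lambda>i. (Inl i, Inr i)) ` {..<m}"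
    by auto
  have "finite ?A"
    unfolding A by simp
  moreover have "m > 0"
    using assms by simp
  ultimately show ?thesis
    using neq neq[symmetric] by unfold_locales
      (auto simp: sun_graph_def symcl_def symmetric_def intro!: symI split: if_splits)
qed

lemma card_sun_graph: "card (pverts (sun_graph m)) = 2 * m"
  by (simp add: sun_graph_def card_Plus flip: Plus_def)

end

theory Submission
  imports Defs
begin

text \<open>
  Let \<open>uv\<close> be the connecting edge. A function on the vertices of \<open>G\<close> that takes equal values
  at \<open>u\<close> and \<open>v\<close> does not see this edge, so for it the eigenvalue equation of \<open>L(G)\<close> splits
  into those of \<open>L(G1)\<close> and \<open>L(G2)\<close>. Given eigenfunctions \<open>f1\<close> and \<open>f2\<close> for the same eigenvalue,
  glue \<open>f1\<close> and \<open>0\<close> if \<open>f1 u = 0\<close>, and \<open>f2 v \<cdot> f1\<close> and \<open>f1 u \<cdot> f2\<close> otherwise.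
\<close>

text \<open>The action of the Laplacian on vertex functions, free of any enumeration. The degree is
  absorbed into differences along arcs, so an arc joining vertices of equal value contributes
  zero.\<close>

definition laplacian_op :: "'a pair_pre_digraph \<Rightarrow> ('a \<Rightarrow> real) \<Rightarrow> 'a \<Rightarrow> real" where
  "laplacian_op G f w = (\<Sum>x | (w, x) \<in> parcs G. f w - f x)"

lemma laplacian_op_scale: "laplacian_op G (\<lambda>x. a * f x) w = a * laplacian_op G f w"
  by (simp add: laplacian_op_def sum_distrib_left right_diff_distrib)

lemma laplacian_op_cong:
  assumes "pair_graph G" and "w \<in> pverts G" and "\<And>x. x \<in> pverts G \<Longrightarrow> f x = g x"
  shows "laplacian_op G f w = laplacian_op G g w"
proof -
  interpret pair_graph G by fact
  have "x \<in> pverts G" if "(w, x) \<in> parcs G" for x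
    using wellformed(2)[of "(w, x)"] that by simp
  then show ?thesis
    unfolding laplacian_op_def using assms(2,3) by (intro sum.cong) auto
qed

lemma laplacian_mat_carrier:
  "laplacian_mat G vs \<in> carrier_mat (length vs) (length vs)"
  by (auto simp: laplacian_mat_def degree_mat_def adjacency_mat_def mat_diag_def)

text \<open>The degree of \<open>w\<close> counts its neighbours, so the diagonal entry supplies one
  copy of \<open>f w\<close> for each of them, to be paired with the term \<open>- f x\<close> of
  the adjacency part.\<close>

lemma laplacian_mat_mult_vec:
  assumes "pair_graph G" and "vertex_enum G vs" and i: "i < length vs"
  shows "(laplacian_mat G vs *\<^sub>v vec (length vs) (\<lambda>j. f (vs ! j))) $ i = laplacian_op G f (vs ! i)"
proof -
  interpret pair_graph G by fact
  let ?n = "length vs" and ?w = "vs ! i"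
  let ?N = "{x. (?w, x) \<in> parcs G}"
  have vs: "distinct vs" "set vs = pverts G"
    using assms(2) by (auto simp: vertex_enum_def)
  have N: "?N \<subseteq> set vs"
    using wellformed(2) vs(2) by fastforce
  have "out_arcs (with_proj G) ?w = Pair ?w ` ?N"
    by (auto simp: out_arcs_def)
  then have deg: "out_degree (with_proj G) ?w = card ?N"
    unfolding out_degree_def by (simp add: card_image inj_on_def)
  have reindex: "(\<Sum>j<?n. h (vs ! j)) = (\<Sum>x\<in>set vs. h x)" for h :: "'a \<Rightarrow> real"
    using sum.reindex_bij_betw[OF bij_betw_nth[OF vs(1) refl refl], of h] by simp
  have "(laplacian_mat G vs *\<^sub>v vec ?n (\<lambda>j. f (vs ! j))) $ i
      = (\<Sum>j<?n. ((if i = j then real (card ?N) else 0)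
          - (if vs ! j \<in> ?N then 1 else 0)) * f (vs ! j))"
    using i by (auto simp: laplacian_mat_def degree_mat_def adjacency_mat_def mat_diag_def
        scalar_prod_def deg atLeast0LessThan intro!: sum.cong)
  also have "\<dots> = (\<Sum>j<?n. (if i = j then card ?N * f (vs ! j) else 0)
      - (if vs ! j \<in> ?N then f (vs ! j) else 0))"
    by (intro sum.cong) (auto simp: left_diff_distrib)
  also have "\<dots> = card ?N * f ?w - (\<Sum>j<?n. if vs ! j \<in> ?N then f (vs ! j) else 0)"
    using i by (simp add: sum_subtractf)
  also have "\<dots> = card ?N * f ?w - (\<Sum>x\<in>set vs. if x \<in> ?N then f x else 0)"
    using reindex[of "\<lambda>x. if x \<in> ?N then f x else 0"] by simp
  also have "\<dots> = card ?N * f ?w - (\<Sum>x\<in>?N. f x)"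
    using sum.inter_restrict[of "set vs" f ?N] N by (simp add: Int_absorb1)
  also have "\<dots> = laplacian_op G f ?w"
    by (simp add: laplacian_op_def sum_subtractf)
  finally show ?thesis .
qed

text \<open>The right-hand side does not mention \<open>vs\<close>, so eigenfunctions of graphs with
  unrelated enumerations can be glued. Values of \<open>f\<close> off \<open>pverts G\<close> have
  no influence.\<close>

lemma eigenvalue_laplacian_mat_iff:
  assumes G: "pair_graph G" and en: "vertex_enum G vs"
  shows "eigenvalue (laplacian_mat G vs) c \<longleftrightarrow>
    (\<exists>f. (\<exists>w\<in>pverts G. f w \<noteq> 0) \<and> (\<forall>w\<in>pverts G. laplacian_op G f w = c * f w))"
proof -
  let ?n = "length vs"
  let ?vec = "\<lambda>f. vec ?n (\<lambda>j. f (vs ! j)) :: real vec"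
  have vs: "distinct vs" "pverts G = set vs"
    using en by (auto simp: vertex_enum_def)
  have dim: "dim_row (laplacian_mat G vs) = ?n"
    using laplacian_mat_carrier[of G vs] by auto
  have ev: "eigenvector (laplacian_mat G vs) (?vec f) c \<longleftrightarrow>
      (\<exists>w\<in>pverts G. f w \<noteq> 0) \<and> (\<forall>w\<in>pverts G. laplacian_op G f w = c * f w)" for f
  proof -
    have "laplacian_mat G vs *\<^sub>v ?vec f = c \<cdot>\<^sub>v ?vec f \<longleftrightarrow>
        (\<forall>i<?n. laplacian_op G f (vs ! i) = c * f (vs ! i))"
      using laplacian_mat_mult_vec[OF G en] dim by (auto simp: vec_eq_iff simp del: index_mult_mat_vec)
    moreover have "?vec f = 0\<^sub>v ?n \<longleftrightarrow> (\<forall>i<?n. f (vs ! i) = 0)"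
      by (auto simp: vec_eq_iff)
    moreover have "?vec f \<in> carrier_vec ?n"
      by simp
    ultimately show ?thesis
      unfolding eigenvector_def dim vs(2) by (auto simp: all_set_conv_all_nth in_set_conv_nth)
  qed
  have "\<exists>f. v = ?vec f" if "v \<in> carrier_vec ?n" for v
  proof
    \<comment> \<open>Every vector comes from a vertex function: look up the position of a vertex in
      the enumeration, which is unique because \<open>vs\<close> is distinct.\<close>
    show "v = ?vec (\<lambda>x. v $ (the_inv_into {..<?n} ((!) vs) x))"
      using that vs(1) by (auto simp: vec_eq_iff the_inv_into_f_f inj_on_nth)
  qed
  moreover have "v \<in> carrier_vec ?n" if "eigenvector (laplacian_mat G vs) v c" for v
    using that by (simp add: eigenvector_def dim)
  ultimately have "eigenvalue (laplacian_mat G vs) c \<longleftrightarrow>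
      (\<exists>f. eigenvector (laplacian_mat G vs) (?vec f) c)"
    unfolding eigenvalue_def by blast
  then show ?thesis
    by (simp only: ev)
qed

lemma doubleton_in_edge_set_iff:
  assumes "pair_graph G"
  shows "{u, v} \<in> edge_set G \<longleftrightarrow> (u, v) \<in> parcs G"
proof -
  interpret pair_graph G by fact
  have "(v, u) \<in> parcs G \<Longrightarrow> (u, v) \<in> parcs G"
    using arcs_symmetric by blast
  then show ?thesis
    by (force simp: edge_set_def doubleton_eq_iff)
qed

text \<open>Passes from edges to arcs, over which \<open>laplacian_op\<close> sums; the joining edge
  becomes two opposite arcs.\<close>

lemma one_edge_connection_parcs:
  assumes "one_edge_connection G1 G2 G"
  obtains u v where "u \<in> pverts G1" and "v \<in> pverts G2"
    and "parcs G = parcs G1 \<union> parcs G2 \<union> {(u, v), (v, u)}"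
proof -
  obtain u v where uv: "u \<in> pverts G1" "v \<in> pverts G2"
    and E: "edge_set G = edge_set G1 \<union> edge_set G2 \<union> {{u, v}}"
    using assms by (auto simp: one_edge_connection_def)
  have "(x, y) \<in> parcs G \<longleftrightarrow> (x, y) \<in> parcs G1 \<union> parcs G2 \<union> {(u, v), (v, u)}" for x y
  proof -
    have "{x, y} \<in> edge_set G \<longleftrightarrow>
        {x, y} \<in> edge_set G1 \<or> {x, y} \<in> edge_set G2 \<or> {x, y} = {u, v}"
      using E by auto
    with assms show ?thesis
      by (auto simp: one_edge_connection_def doubleton_in_edge_set_iff doubleton_eq_iff)
  qed
  then have "parcs G = parcs G1 \<union> parcs G2 \<union> {(u, v), (v, u)}"
    by (simp only: set_eq_iff split_paired_All simp_thms)
  then show thesis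
    by (rule that[OF uv])
qed

text \<open>Apart from arcs of \<open>G1\<close>, only \<open>(u, v)\<close> can leave a vertex of
  \<open>G1\<close>, and its term \<open>f u - f v\<close> vanishes.\<close>

lemma laplacian_op_add_edge:
  assumes G1: "pair_graph G1" and G2: "pair_graph G2"
    and disj: "pverts G1 \<inter> pverts G2 = {}"
    and u: "u \<in> pverts G1" and v: "v \<in> pverts G2"
    and arcs: "parcs G = parcs G1 \<union> parcs G2 \<union> {(u, v), (v, u)}"
    and w: "w \<in> pverts G1" and eq: "f u = f v"
  shows "laplacian_op G f w = laplacian_op G1 f w"
proof -
  interpret G1: pair_graph G1 by fact
  interpret G2: pair_graph G2 by fact
  have w2: "(w, x) \<notin> parcs G2" for x
    using G2.wellformed(1)[of "(w, x)"] w disj by auto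
  have v1: "(w, v) \<notin> parcs G1"
    using G1.wellformed(2)[of "(w, v)"] v disj by auto
  \<comment> \<open>Finiteness is required to split the new neighbour \<open>v\<close> off the sum
    at \<open>w = u\<close>.\<close>
  have "{x. (w, x) \<in> parcs G1} \<subseteq> snd ` parcs G1"
    by force
  then have fin: "finite {x. (w, x) \<in> parcs G1}"
    using G1.pair_finite_arcs finite_surj by blast
  have "w \<noteq> v"
    using w v disj by auto
  then have "{x. (w, x) \<in> parcs G} =
      (if w = u then insert v {x. (w, x) \<in> parcs G1} else {x. (w, x) \<in> parcs G1})"
    using w2 by (auto simp: arcs)
  then show ?thesis
    using fin v1 eq by (cases "w = u") (simp_all add: laplacian_op_def)
qed

theorem eigenvalue_one_edge_connection:
  assumes con: "one_edge_connection G1 G2 G"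
    and "vertex_enum G1 vs1" and "vertex_enum G2 vs2" and "vertex_enum G vs"
    and "eigenvalue (laplacian_mat G1 vs1) c" and "eigenvalue (laplacian_mat G2 vs2) c"
  shows "eigenvalue (laplacian_mat G vs) c"
proof -
  have G: "pair_graph G1" "pair_graph G2" "pair_graph G"
    and disj: "pverts G1 \<inter> pverts G2 = {}" and verts: "pverts G = pverts G1 \<union> pverts G2"
    using con by (auto simp: one_edge_connection_def)
  obtain u v where u: "u \<in> pverts G1" and v: "v \<in> pverts G2"
    and arcs: "parcs G = parcs G1 \<union> parcs G2 \<union> {(u, v), (v, u)}"
    using con by (rule one_edge_connection_parcs)
  obtain f1 where f1: "\<exists>w\<in>pverts G1. f1 w \<noteq> 0" "\<forall>w\<in>pverts G1. laplacian_op G1 f1 w = c * f1 w"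
    using assms eigenvalue_laplacian_mat_iff[OF G(1)] by blast
  obtain f2 where f2: "\<exists>w\<in>pverts G2. f2 w \<noteq> 0" "\<forall>w\<in>pverts G2. laplacian_op G2 f2 w = c * f2 w"
    using assms eigenvalue_laplacian_mat_iff[OF G(2)] by blast
  \<comment> \<open>A nontrivial solution of one homogeneous linear equation in two unknowns. In the
    second case \<open>a\<close> may be 0, but \<open>b = f1 u\<close> is not.\<close>
  obtain a b where ab: "a * f1 u = b * f2 v" "a \<noteq> 0 \<or> b \<noteq> 0"
  proof (cases "f1 u = 0")
    case True
    then show thesis using that[of 1 0] by simp
  next
    case False
    then show thesis using that[of "f2 v" "f1 u"] by simp
  qed
  define f where "f = (\<lambda>x. if x \<in> pverts G1 then a * f1 x else b * f2 x)"
  have on1: "f x = a * f1 x" if "x \<in> pverts G1" for x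
    using that by (simp add: f_def)
  have on2: "f x = b * f2 x" if "x \<in> pverts G2" for x
    using that disj by (auto simp: f_def)
  have eq: "f u = f v"
    using ab(1) on1[OF u] on2[OF v] by simp
  have "laplacian_op G f w = c * f w" if w: "w \<in> pverts G1" for w
    using laplacian_op_add_edge[OF G(1,2) disj u v arcs w eq] laplacian_op_cong[OF G(1) w on1]
      f1(2) w on1[OF w] by (simp add: laplacian_op_scale)
  moreover have "laplacian_op G f w = c * f w" if w: "w \<in> pverts G2" for w
  proof -
    \<comment> \<open>The same lemma with the two graphs, and the two ends of the joining edge,
      exchanged.\<close>
    have "laplacian_op G f w = laplacian_op G2 f w"
      using disj arcs by (intro laplacian_op_add_edge[OF G(2,1) _ v u _ w eq[symmetric]]) auto
    then show ?thesis
      using laplacian_op_cong[OF G(2) w on2] f2(2) w on2[OF w] by (simp add: laplacian_op_scale)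
  qed
  moreover have "\<exists>w\<in>pverts G. f w \<noteq> 0"
  proof -
    \<comment> \<open>A nonzero coefficient keeps its eigenfunction alive on its own side, since the
      two vertex sets are disjoint.\<close>
    obtain w1 w2 where w: "w1 \<in> pverts G1" "f1 w1 \<noteq> 0" "w2 \<in> pverts G2" "f2 w2 \<noteq> 0"
      using f1(1) f2(1) by blast
    then have "f w1 \<noteq> 0 \<or> f w2 \<noteq> 0"
      using ab(2) by (simp add: on1 on2)
    then show ?thesis
      using w verts by blast
  qed
  ultimately show ?thesis
    using eigenvalue_laplacian_mat_iff[OF G(3) assms(4)] verts by blast
qed

theorem theorem15:
  fixes G1 G2 G :: "'a pair_pre_digraph"
    and vs1 vs2 vs :: "'a list"
    and n1 n2 :: nat
  assumes "broken_sun G1"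
    and "card (pverts G1) = n1"
    and "\<not> has_perfect_matching G1"
    and "unicyclic G2"
    and "card (pverts G2) = n2"
    and "has_perfect_matching G2"
    and "vertex_enum G1 vs1"
    and "vertex_enum G2 vs2"
    and "eigenvalue (laplacian_mat G1 vs1) 2"
    and "eigenvalue (laplacian_mat G2 vs2) 2"
    and "one_edge_connection G1 G2 G"
    and "vertex_enum G vs"
  shows "eigenvalue (laplacian_mat G vs) 2"
  using eigenvalue_one_edge_connection[OF assms(11,7,8,12,9,10)] .

end
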